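(* For $\alpha,\beta,\gamma,\delta\in\mathbb{R}$ consider the vector field $$\mathbf{u}=(-\alpha t+\beta)\frac{\partial}{\partial t}+(\alpha q_1+\gamma q_2)\frac{\partial}{\partial q_1}+(-\gamma q_1+\alpha q_2)\frac{\partial}{\partial q_2}+(\alpha q_3+\delta)\frac{\partial}{\partial q_3},$$ which is a Lie point symmetry of the Euler-Lagrange equations $$\ddot q_1-q_1\dot q_3=0,\qquad \ddot q_2-q_2\dot q_3=0,\qquad \ddot q_3+q_1\dot q_1+q_2\dot q_2=0$$ of the Lagrangian $L=\frac12\dot q_1^2+\frac12\dot q_2^2+\frac12\dot q_3^2+\frac12\dot q_3(q_1^2+q_2^2)$. In the case $\alpha=0$, $\mathbf{u}$ is a variational symmetry of these equations.
   Context: A vector field $\mathbf{u}=\xi\frac{\partial}{\partial t}+\sum_{i=1}^3\eta_i\frac{\partial}{\partial q_i}$, with $\xi,\eta_i$ functions of $(q_1,q_2,q_3,t)$, is a variational symmetry of the Euler-Lagrange equations of $L$ if and only if $pr^{(1)}(\mathbf{u})L+L\dot\xi=0$, where $$pr^{(1)}(\mathbf{u})=\mathbf{u}+\sum_{i=1}^3(\dot\eta_i-\dot\xi\dot q_i)\frac{\partial}{\partial\dot q_i}$$ is the first prolongation and dots on $\xi,\eta_i$ denote total time derivatives, e.g. $\dot\xi=\frac{\partial\xi}{\partial t}+\sum_j\dot q_j\frac{\partial\xi}{\partial q_j}$. *)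

theory Defs
  imports "HOL-Analysis.Analysis"
begin

text \<open>
  Functions of \<open>t, q\<close>, of \<open>t, q, v\<close> and of \<open>t, q, v, a\<close> are functions on the jet spaces of order
  0, 1 and 2 of curves \<open>t \<mapsto> q(t)\<close>; the independent jet coordinates \<open>v\<close> and \<open>a\<close> stand for
  \<open>q\<close> dot and \<open>q\<close> double dot. All functions are meant to be smooth; \<^const>\<open>deriv\<close> carries no
  information at points of non-differentiability.
\<close>

type_synonym 'n jet0 = "real \<Rightarrow> real ^ 'n \<Rightarrow> real"
type_synonym 'n jet1 = "real \<Rightarrow> real ^ 'n \<Rightarrow> real ^ 'n \<Rightarrow> real"
type_synonym 'n jet2 = "real \<Rightarrow> real ^ 'n \<Rightarrow> real ^ 'n \<Rightarrow> real ^ 'n \<Rightarrow> real"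

definition pderiv_at :: "'n::finite \<Rightarrow> (real ^ 'n \<Rightarrow> real) \<Rightarrow> real ^ 'n \<Rightarrow> real" where
  "pderiv_at i f x = deriv (\<lambda>s. f (x + s *\<^sub>R axis i 1)) 0"

definition total_deriv0 :: "('n::finite) jet0 \<Rightarrow> 'n jet1" where
  "total_deriv0 f t q v =
     deriv (\<lambda>s. f s q) t + (\<Sum>j\<in>UNIV. v $ j * pderiv_at j (f t) q)"

definition total_deriv1 :: "('n::finite) jet1 \<Rightarrow> 'n jet2" where
  "total_deriv1 f t q v a =
     deriv (\<lambda>s. f s q v) t
     + (\<Sum>j\<in>UNIV. v $ j * pderiv_at j (\<lambda>y. f t y v) q)
     + (\<Sum>j\<in>UNIV. a $ j * pderiv_at j (f t q) v)"

definition euler_lagrange :: "('n::finite) jet1 \<Rightarrow> 'n \<Rightarrow> 'n jet2" where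
  "euler_lagrange L i t q v a =
     total_deriv1 (\<lambda>t q v. pderiv_at i (L t q) v) t q v a - pderiv_at i (\<lambda>y. L t y v) q"

text \<open>
  A vector field \<open>\<xi> \<partial>/\<partial>t + \<Sum>i. \<eta> i \<partial>/\<partial>q i\<close> is given by its coefficients \<open>\<xi>\<close> and \<open>\<eta>\<close>. The following
  are the coefficients of \<open>\<partial>/\<partial>v i\<close> and \<open>\<partial>/\<partial>a i\<close> in its prolongations.
\<close>

definition prolong_coeff1 :: "('n::finite) jet0 \<Rightarrow> ('n \<Rightarrow> 'n jet0) \<Rightarrow> 'n \<Rightarrow> 'n jet1" where
  "prolong_coeff1 \<xi> \<eta> i t q v = total_deriv0 (\<eta> i) t q v - total_deriv0 \<xi> t q v * v $ i"

definition prolong_coeff2 :: "('n::finite) jet0 \<Rightarrow> ('n \<Rightarrow> 'n jet0) \<Rightarrow> 'n \<Rightarrow> 'n jet2" where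
  "prolong_coeff2 \<xi> \<eta> i t q v a =
     total_deriv1 (prolong_coeff1 \<xi> \<eta> i) t q v a - total_deriv0 \<xi> t q v * a $ i"

definition prolong1 :: "('n::finite) jet0 \<Rightarrow> ('n \<Rightarrow> 'n jet0) \<Rightarrow> 'n jet1 \<Rightarrow> 'n jet1" where
  "prolong1 \<xi> \<eta> F t q v =
     \<xi> t q * deriv (\<lambda>s. F s q v) t
     + (\<Sum>i\<in>UNIV. \<eta> i t q * pderiv_at i (\<lambda>y. F t y v) q)
     + (\<Sum>i\<in>UNIV. prolong_coeff1 \<xi> \<eta> i t q v * pderiv_at i (F t q) v)"

definition prolong2 :: "('n::finite) jet0 \<Rightarrow> ('n \<Rightarrow> 'n jet0) \<Rightarrow> 'n jet2 \<Rightarrow> 'n jet2" where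
  "prolong2 \<xi> \<eta> F t q v a =
     \<xi> t q * deriv (\<lambda>s. F s q v a) t
     + (\<Sum>i\<in>UNIV. \<eta> i t q * pderiv_at i (\<lambda>y. F t y v a) q)
     + (\<Sum>i\<in>UNIV. prolong_coeff1 \<xi> \<eta> i t q v * pderiv_at i (\<lambda>w. F t q w a) v)
     + (\<Sum>i\<in>UNIV. prolong_coeff2 \<xi> \<eta> i t q v a * pderiv_at i (F t q v) a)"

definition variational_symmetry :: "('n::finite) jet1 \<Rightarrow> 'n jet0 \<Rightarrow> ('n \<Rightarrow> 'n jet0) \<Rightarrow> bool" where
  "variational_symmetry L \<xi> \<eta> \<longleftrightarrow>
     (\<forall>t q v. prolong1 \<xi> \<eta> L t q v + L t q v * total_deriv0 \<xi> t q v = 0)"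

text \<open>
  Infinitesimal symmetry criterion for the second-order system \<open>E i = 0\<close>: the second prolongation
  annihilates the equations on their common zero set. It presupposes that the system has maximal
  rank, as it does when the Jacobian with respect to \<open>a\<close> is invertible.
\<close>

definition lie_point_symmetry ::
  "('i \<Rightarrow> ('n::finite) jet2) \<Rightarrow> 'n jet0 \<Rightarrow> ('n \<Rightarrow> 'n jet0) \<Rightarrow> bool" where
  "lie_point_symmetry E \<xi> \<eta> \<longleftrightarrow>
     (\<forall>t q v a. (\<forall>i. E i t q v a = 0) \<longrightarrow> (\<forall>i. prolong2 \<xi> \<eta> (E i) t q v a = 0))"

definition lagrangian :: "3 jet1" where
  "lagrangian t q v =
     1/2 * (v $ 1)\<^sup>2 + 1/2 * (v $ 2)\<^sup>2 + 1/2 * (v $ 3)\<^sup>2 + 1/2 * v $ 3 * ((q $ 1)\<^sup>2 + (q $ 2)\<^sup>2)"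

definition u_t :: "real \<Rightarrow> real \<Rightarrow> 3 jet0" where
  "u_t \<alpha> \<beta> t q = - \<alpha> * t + \<beta>"

definition u_q :: "real \<Rightarrow> real \<Rightarrow> real \<Rightarrow> 3 \<Rightarrow> 3 jet0" where
  "u_q \<alpha> \<gamma> \<delta> i t q =
     (vector [\<alpha> * q $ 1 + \<gamma> * q $ 2, - \<gamma> * q $ 1 + \<alpha> * q $ 2, \<alpha> * q $ 3 + \<delta>] :: real ^ 3) $ i"

end

theory Submission
  imports Defs
begin

text \<open>
  All functions involved are polynomials in the jet coordinates, so everything reduces to
  computing the total derivatives and prolongations of polynomials. The computation comes out as
  it does because of the groups that the parameters generate. The parameter \<open>\<gamma>\<close> generates the rotations of the
  \<open>q\<^sub>1 q\<^sub>2\<close>-plane, and the Lagrangian depends on \<open>q\<^sub>1, q\<^sub>2, v\<^sub>1, v\<^sub>2\<close> through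
  rotation-invariant expressions only; \<open>\<beta>\<close> and \<open>\<delta>\<close> generate translations in \<open>t\<close> and \<open>q\<^sub>3\<close>, on
  which the Lagrangian does not depend. The parameter \<open>\<alpha>\<close> generates a scaling that gives \<open>t\<close>
  weight \<open>-1\<close> and \<open>q\<close> weight \<open>1\<close>, hence \<open>v\<close> weight \<open>2\<close> and \<open>a\<close> weight \<open>3\<close>. All terms
  of the equations have weight \<open>3\<close>, and therefore the prolonged field maps the vector of left-hand
  sides to a constant linear combination of itself (lemma \<open>prolong2_euler_lagrange\<close>). All terms of
  the Lagrangian have weight \<open>4\<close>, and \<open>L dt\<close> has weight \<open>3\<close>: its variation is \<open>3 \<alpha> L\<close>
  (lemma \<open>variation_lagrangian\<close>), which vanishes for \<open>\<alpha> = 0\<close>.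
\<close>

lemma pderiv_at_eq:
  assumes "(f has_derivative f') (at x)"
  shows "pderiv_at i f x = f' (axis i 1)"
proof -
  interpret f': bounded_linear f'
    using assms by (rule has_derivative_bounded_linear)
  have f: "(f has_derivative f') (at (x + 0 *\<^sub>R axis i 1))"
    using assms by simp
  have "((\<lambda>s. x + s *\<^sub>R axis i 1) has_derivative (\<lambda>s. s *\<^sub>R axis i 1)) (at 0)"
    by (auto intro!: derivative_eq_intros)
  from has_derivative_compose[OF this f]
  have "((\<lambda>s. f (x + s *\<^sub>R axis i 1)) has_real_derivative f' (axis i 1)) (at 0)"
    by (simp add: has_field_derivative_def f'.scaleR mult_commute_abs)
  then show ?thesis
    unfolding pderiv_at_def by (rule DERIV_imp_deriv)
qed

text \<open>
  By linearity of the Frechet derivative, the sums over coordinates in total derivatives and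
  prolongations are directional derivatives. Evaluating them in this form avoids computing partial
  derivatives one coordinate at a time.
\<close>

lemma sum_pderiv_at:
  assumes "(f has_derivative f') (at x)"
  shows "(\<Sum>j\<in>UNIV. c j * pderiv_at j f x) = f' (\<chi> j. c j)"
proof -
  interpret f': bounded_linear f'
    using assms by (rule has_derivative_bounded_linear)
  have "(\<chi> j. c j) = (\<Sum>j\<in>UNIV. c j *\<^sub>R axis j 1)"
    using basis_expansion[of "\<chi> j. c j"] by (simp add: scalar_mult_eq_scaleR)
  then show ?thesis
    by (simp add: pderiv_at_eq[OF assms] f'.sum f'.scaleR)
qed

lemma total_deriv0_eq:
  assumes "((\<lambda>s. f s q) has_real_derivative ft) (at t)"
    and "(f t has_derivative fq) (at q)"
  shows "total_deriv0 f t q v = ft + fq v"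
  unfolding total_deriv0_def
  by (simp add: DERIV_imp_deriv[OF assms(1)] sum_pderiv_at[OF assms(2)])

lemma total_deriv1_eq:
  assumes "((\<lambda>s. f s q v) has_real_derivative ft) (at t)"
    and "((\<lambda>y. f t y v) has_derivative fq) (at q)"
    and "(f t q has_derivative fv) (at v)"
  shows "total_deriv1 f t q v a = ft + fq v + fv a"
  unfolding total_deriv1_def
  by (simp add: DERIV_imp_deriv[OF assms(1)] sum_pderiv_at[OF assms(2)] sum_pderiv_at[OF assms(3)])

lemma prolong1_eq:
  assumes "((\<lambda>s. F s q v) has_real_derivative Ft) (at t)"
    and "((\<lambda>y. F t y v) has_derivative Fq) (at q)"
    and "(F t q has_derivative Fv) (at v)"
  shows "prolong1 \<xi> \<eta> F t q v =
    \<xi> t q * Ft + Fq (\<chi> i. \<eta> i t q) + Fv (\<chi> i. prolong_coeff1 \<xi> \<eta> i t q v)"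
  unfolding prolong1_def
  by (simp add: DERIV_imp_deriv[OF assms(1)] sum_pderiv_at[OF assms(2)] sum_pderiv_at[OF assms(3)])

lemma prolong2_eq:
  assumes "((\<lambda>s. F s q v a) has_real_derivative Ft) (at t)"
    and "((\<lambda>y. F t y v a) has_derivative Fq) (at q)"
    and "((\<lambda>w. F t q w a) has_derivative Fv) (at v)"
    and "(F t q v has_derivative Fa) (at a)"
  shows "prolong2 \<xi> \<eta> F t q v a =
    \<xi> t q * Ft + Fq (\<chi> i. \<eta> i t q) + Fv (\<chi> i. prolong_coeff1 \<xi> \<eta> i t q v)
    + Fa (\<chi> i. prolong_coeff2 \<xi> \<eta> i t q v a)"
  unfolding prolong2_def
  by (simp add: DERIV_imp_deriv[OF assms(1)] sum_pderiv_at[OF assms(2)] sum_pderiv_at[OF assms(3)]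
      sum_pderiv_at[OF assms(4)])

lemmas has_derivative_nth [derivative_intros] =
  bounded_linear.has_derivative[OF bounded_linear_vec_nth]

lemma has_derivative_lagrangian_q:
  "((\<lambda>y. lagrangian t y v) has_derivative (\<lambda>h. v $ 3 * (q $ 1 * h $ 1 + q $ 2 * h $ 2))) (at q)"
  unfolding lagrangian_def
  by (rule derivative_eq_intros refl | simp add: fun_eq_iff field_simps)+

lemma has_derivative_lagrangian_v:
  "(lagrangian t q has_derivative
     (\<lambda>h. v $ 1 * h $ 1 + v $ 2 * h $ 2 + v $ 3 * h $ 3 + 1/2 * h $ 3 * ((q $ 1)\<^sup>2 + (q $ 2)\<^sup>2))) (at v)"
  unfolding lagrangian_def
  by (rule derivative_eq_intros refl | simp add: fun_eq_iff field_simps)+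

lemma momentum_lagrangian:
  "pderiv_at 1 (lagrangian t q) v = v $ 1"
  "pderiv_at 2 (lagrangian t q) v = v $ 2"
  "pderiv_at 3 (lagrangian t q) v = v $ 3 + 1/2 * ((q $ 1)\<^sup>2 + (q $ 2)\<^sup>2)"
  by (simp_all add: pderiv_at_eq[OF has_derivative_lagrangian_v] axis_def)

lemma euler_lagrange_lagrangian:
  "euler_lagrange lagrangian 1 = (\<lambda>t q v a. a $ 1 - q $ 1 * v $ 3)"
  "euler_lagrange lagrangian 2 = (\<lambda>t q v a. a $ 2 - q $ 2 * v $ 3)"
  "euler_lagrange lagrangian 3 = (\<lambda>t q v a. a $ 3 + q $ 1 * v $ 1 + q $ 2 * v $ 2)"
proof -
  have "total_deriv1 (\<lambda>t q v. v $ i) t q v a = a $ i" for i :: 3 and t q v a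
    by (rule total_deriv1_eq[THEN trans], (rule derivative_eq_intros refl)+, simp)
  moreover have "total_deriv1 (\<lambda>t q v. v $ 3 + 1/2 * ((q $ 1)\<^sup>2 + (q $ 2)\<^sup>2)) t q v a
      = a $ 3 + q $ 1 * v $ 1 + q $ 2 * v $ 2" for t and q v a :: "real ^ 3"
    by (rule total_deriv1_eq[THEN trans], (rule derivative_eq_intros refl)+, simp add: field_simps)
  ultimately show
    "euler_lagrange lagrangian 1 = (\<lambda>t q v a. a $ 1 - q $ 1 * v $ 3)"
    "euler_lagrange lagrangian 2 = (\<lambda>t q v a. a $ 2 - q $ 2 * v $ 3)"
    "euler_lagrange lagrangian 3 = (\<lambda>t q v a. a $ 3 + q $ 1 * v $ 1 + q $ 2 * v $ 2)"
    unfolding euler_lagrange_def momentum_lagrangian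
    by (simp_all add: fun_eq_iff pderiv_at_eq[OF has_derivative_lagrangian_q] axis_def)
qed

lemma u_q_component:
  "u_q \<alpha> \<gamma> \<delta> 1 = (\<lambda>t q. \<alpha> * q $ 1 + \<gamma> * q $ 2)"
  "u_q \<alpha> \<gamma> \<delta> 2 = (\<lambda>t q. - \<gamma> * q $ 1 + \<alpha> * q $ 2)"
  "u_q \<alpha> \<gamma> \<delta> 3 = (\<lambda>t q. \<alpha> * q $ 3 + \<delta>)"
  by (simp_all add: u_q_def fun_eq_iff)

lemma total_deriv0_u_t: "total_deriv0 (u_t \<alpha> \<beta>) t q v = - \<alpha>"
  unfolding u_t_def
  by (rule total_deriv0_eq[THEN trans], (rule derivative_eq_intros refl)+, simp)

lemma total_deriv0_u_q:
  "total_deriv0 (u_q \<alpha> \<gamma> \<delta> 1) t q v = \<alpha> * v $ 1 + \<gamma> * v $ 2"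
  "total_deriv0 (u_q \<alpha> \<gamma> \<delta> 2) t q v = - \<gamma> * v $ 1 + \<alpha> * v $ 2"
  "total_deriv0 (u_q \<alpha> \<gamma> \<delta> 3) t q v = \<alpha> * v $ 3"
  unfolding u_q_component
  by (rule total_deriv0_eq[THEN trans], (rule derivative_eq_intros refl)+, simp)+

text \<open>
  Each differentiation in \<open>t\<close> adds \<open>\<alpha>\<close> to the scaling weight, since \<open>t\<close> has weight \<open>-1\<close>.
\<close>

lemma prolong_coeff1_u:
  "prolong_coeff1 (u_t \<alpha> \<beta>) (u_q \<alpha> \<gamma> \<delta>) 1 = (\<lambda>t q v. 2 * \<alpha> * v $ 1 + \<gamma> * v $ 2)"
  "prolong_coeff1 (u_t \<alpha> \<beta>) (u_q \<alpha> \<gamma> \<delta>) 2 = (\<lambda>t q v. - \<gamma> * v $ 1 + 2 * \<alpha> * v $ 2)"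
  "prolong_coeff1 (u_t \<alpha> \<beta>) (u_q \<alpha> \<gamma> \<delta>) 3 = (\<lambda>t q v. 2 * \<alpha> * v $ 3)"
  by (simp_all add: prolong_coeff1_def total_deriv0_u_t total_deriv0_u_q fun_eq_iff)

lemma prolong_coeff2_u:
  "prolong_coeff2 (u_t \<alpha> \<beta>) (u_q \<alpha> \<gamma> \<delta>) 1 t q v a = 3 * \<alpha> * a $ 1 + \<gamma> * a $ 2"
  "prolong_coeff2 (u_t \<alpha> \<beta>) (u_q \<alpha> \<gamma> \<delta>) 2 t q v a = - \<gamma> * a $ 1 + 3 * \<alpha> * a $ 2"
  "prolong_coeff2 (u_t \<alpha> \<beta>) (u_q \<alpha> \<gamma> \<delta>) 3 t q v a = 3 * \<alpha> * a $ 3"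
  unfolding prolong_coeff2_def prolong_coeff1_u total_deriv0_u_t
  by (rule arg_cong2[where f = "(-)", OF total_deriv1_eq refl, THEN trans],
      (rule derivative_eq_intros refl)+, simp)+

text \<open>
  The left-hand sides transform like the accelerations: scaling with weight \<open>3\<close>, and the first two
  rotate into each other. The right-hand sides are linear in the left-hand sides of the equations, which
  makes them vanish on the solution set.
\<close>

lemma prolong2_euler_lagrange:
  fixes \<alpha> \<beta> \<gamma> \<delta> :: real and E
  defines "E \<equiv> euler_lagrange lagrangian"
  shows "prolong2 (u_t \<alpha> \<beta>) (u_q \<alpha> \<gamma> \<delta>) (E 1) t q v a
      = 3 * \<alpha> * E 1 t q v a + \<gamma> * E 2 t q v a"
    and "prolong2 (u_t \<alpha> \<beta>) (u_q \<alpha> \<gamma> \<delta>) (E 2) t q v a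
      = - \<gamma> * E 1 t q v a + 3 * \<alpha> * E 2 t q v a"
    and "prolong2 (u_t \<alpha> \<beta>) (u_q \<alpha> \<gamma> \<delta>) (E 3) t q v a = 3 * \<alpha> * E 3 t q v a"
  unfolding E_def euler_lagrange_lagrangian
  by (rule prolong2_eq[THEN trans], (rule derivative_eq_intros refl)+,
      simp add: prolong_coeff1_u prolong_coeff2_u u_q_component algebra_simps)+

lemma variation_lagrangian:
  "prolong1 (u_t \<alpha> \<beta>) (u_q \<alpha> \<gamma> \<delta>) lagrangian t q v
     + lagrangian t q v * total_deriv0 (u_t \<alpha> \<beta>) t q v = 3 * \<alpha> * lagrangian t q v"
proof -
  have "((\<lambda>s. lagrangian s q v) has_real_derivative 0) (at t)"
    by (simp add: lagrangian_def)
  then show ?thesis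
    by (simp add: prolong1_eq[OF _ has_derivative_lagrangian_q has_derivative_lagrangian_v]
        prolong_coeff1_u u_q_component total_deriv0_u_t)
      (simp add: lagrangian_def power2_eq_square field_simps)
qed

theorem proposition3p3:
  fixes \<alpha> \<beta> \<gamma> \<delta> :: real
  shows "(\<forall>t q v a. (\<forall>i. euler_lagrange lagrangian i t q v a = 0) \<longleftrightarrow>
            a $ 1 - q $ 1 * v $ 3 = 0 \<and>
            a $ 2 - q $ 2 * v $ 3 = 0 \<and>
            a $ 3 + q $ 1 * v $ 1 + q $ 2 * v $ 2 = 0)
       \<and> lie_point_symmetry (euler_lagrange lagrangian) (u_t \<alpha> \<beta>) (u_q \<alpha> \<gamma> \<delta>)
       \<and> (\<alpha> = 0 \<longrightarrow> variational_symmetry lagrangian (u_t \<alpha> \<beta>) (u_q \<alpha> \<gamma> \<delta>))"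
proof (intro conjI impI)
  show "\<forall>t q v a. (\<forall>i. euler_lagrange lagrangian i t q v a = 0) \<longleftrightarrow>
            a $ 1 - q $ 1 * v $ 3 = 0 \<and>
            a $ 2 - q $ 2 * v $ 3 = 0 \<and>
            a $ 3 + q $ 1 * v $ 1 + q $ 2 * v $ 2 = 0"
    by (simp add: forall_3 euler_lagrange_lagrangian)
  show "lie_point_symmetry (euler_lagrange lagrangian) (u_t \<alpha> \<beta>) (u_q \<alpha> \<gamma> \<delta>)"
    by (simp add: lie_point_symmetry_def forall_3 prolong2_euler_lagrange)
  show "variational_symmetry lagrangian (u_t \<alpha> \<beta>) (u_q \<alpha> \<gamma> \<delta>)" if "\<alpha> = 0"
    using that variation_lagrangian[of \<alpha>] by (simp add: variational_symmetry_def)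
qed

end
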